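(* Let $N$ and $L$ be integers with $1<L\le N/2$ and put $K=N-L+1$. Let $\mathbf{A}=(a_{i,j})_{i,j=0}^{L-1}\in\mathbb{R}^{L\times L}$ and $\mathbf{B}=(b_{i,j})_{i,j=0}^{K-1}\in\mathbb{R}^{K\times K}$ be symmetric non-negative definite matrices and let $\mathbf{W}\in\mathbb{R}^{N\times N}$ be a symmetric positive definite matrix (rows and columns indexed by $0,\dots,N-1$). Then the equality $\|\mathcal{T}_L(\mathbf{z})\|_{\mathbf{A},\mathbf{B}}=\|\mathbf{z}\|_{\mathbf{W}}$ holds for every $\mathbf{z}\in\mathbb{R}^N$ if and only if $\mathbf{W}=\mathbf{A}\ast\mathbf{B}$.
   Context: Trajectory matrix: for $\mathbf{z}=(z_0,\dots,z_{N-1})^\top$, $\mathcal{T}_L(\mathbf{z})\in\mathbb{R}^{L\times K}$ is the Hankel matrix with entries $(\mathcal{T}_L(\mathbf{z}))_{l,k}=z_{l+k}$, $l=0,\dots,L-1$, $k=0,\dots,K-1$. (Semi)norms: $\|\mathbf{X}\|_{\mathbf{A},\mathbf{B}}=\sqrt{\operatorname{tr}(\mathbf{A}\mathbf{X}\mathbf{B}\mathbf{X}^\top)}$ for $\mathbf{X}\in\mathbb{R}^{L\times K}$, and $\|\mathbf{z}\|_{\mathbf{W}}=\sqrt{\mathbf{z}^\top\mathbf{W}\mathbf{z}}$ for $\mathbf{z}\in\mathbb{R}^N$. Matrix convolution: for $\mathbf{A}=(a_{i,j})_{i,j=0}^{A}$ and $\mathbf{B}=(b_{i,j})_{i,j=0}^{B}$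 the matrix $\mathbf{C}=\mathbf{A}\ast\mathbf{B}=(c_{i,j})_{i,j=0}^{A+B}$ has entries $c_{i,j}=\sum_{k,l}a_{k,l}\,b_{i-k,j-l}$, the sum being over $\max\{0,i-B\}\le k\le\min\{A,i\}$, $\max\{0,j-B\}\le l\le\min\{A,j\}$. (Here $A=L-1$, $B=K-1$, $A+B=N-1$.) *)

theory Defs
  imports Complex_Main "Jordan_Normal_Form.Matrix"
begin

definition symmetric_mat :: "'a mat \<Rightarrow> bool" where
  "symmetric_mat A \<longleftrightarrow> transpose_mat A = A"

definition nonneg_definite :: "real mat \<Rightarrow> bool" where
  "nonneg_definite A \<longleftrightarrow>
     square_mat A \<and> (\<forall>x \<in> carrier_vec (dim_row A). 0 \<le> x \<bullet> (A *\<^sub>v x))"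

definition pos_definite :: "real mat \<Rightarrow> bool" where
  "pos_definite A \<longleftrightarrow>
     square_mat A \<and>
     (\<forall>x \<in> carrier_vec (dim_row A). x \<noteq> 0\<^sub>v (dim_row A) \<longrightarrow> 0 < x \<bullet> (A *\<^sub>v x))"

definition mat_trace :: "'a :: comm_monoid_add mat \<Rightarrow> 'a" where
  "mat_trace A = (\<Sum>i < dim_row A. A $$ (i, i))"

(* The number of columns is K = N - L + 1 for N = dim_vec z; meaningful for L \<le> N. *)
definition trajectory_mat :: "nat \<Rightarrow> 'a vec \<Rightarrow> 'a mat" where
  "trajectory_mat L z = mat L (dim_vec z - L + 1) (\<lambda>(l, k). z $ (l + k))"

definition mat_seminorm :: "real mat \<Rightarrow> real mat \<Rightarrow> real mat \<Rightarrow> real" where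
  "mat_seminorm A B X = sqrt (mat_trace (A * X * B * transpose_mat X))"

definition vec_seminorm :: "real mat \<Rightarrow> real vec \<Rightarrow> real" where
  "vec_seminorm W z = sqrt (z \<bullet> (W *\<^sub>v z))"

(* Two-dimensional convolution of nonempty matrices. The largest row index of B is
   dim_row B - 1, so the truncated subtraction i - (dim_row B - 1) on nat is the lower
   summation limit max {0, i - (dim_row B - 1)}; likewise for columns. *)
definition mat_conv :: "'a :: comm_semiring_0 mat \<Rightarrow> 'a mat \<Rightarrow> 'a mat" where
  "mat_conv A B =
     mat (dim_row A + dim_row B - 1) (dim_col A + dim_col B - 1)
       (\<lambda>(i, j).
          \<Sum>k = i - (dim_row B - 1)..min (dim_row A - 1) i.
          \<Sum>l = j - (dim_col B - 1)..min (dim_col A - 1) j.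
            A $$ (k, l) * B $$ (i - k, j - l))"

end

(* Expanding the trace and using the symmetry of B, the squared seminorm of the trajectory matrix
   is the sum of a(k,l) b(m,n) z(k+m) z(l+n). Collecting the terms with k + m = i and l + n = j
   turns it into the quadratic form of the convolution of A and B, and by polarization a
   symmetric matrix is determined by its quadratic form. *)

theory Submission
  imports Defs
begin

lemma symmetric_mat_index:
  assumes "symmetric_mat M" "M \<in> carrier_mat n n" "i < n" "j < n"
  shows "M $$ (i, j) = M $$ (j, i)"
  by (metis assms carrier_matD index_transpose_mat(1) symmetric_mat_def)

lemma quadratic_form_eq_sum:
  fixes M :: "'a :: comm_semiring_0 mat"
  assumes "M \<in> carrier_mat n n" "z \<in> carrier_vec n"
  shows "z \<bullet> (M *\<^sub>v z) = (\<Sum>i<n. \<Sum>j<n. z $ i * z $ j * M $$ (i, j))"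
  using assms
  by (auto simp: scalar_prod_def atLeast0LessThan sum_distrib_left ac_simps intro!: sum.cong)

lemma unit_vec_quadratic_form:
  fixes M :: "'a :: comm_semiring_1 mat"
  assumes "M \<in> carrier_mat n n" "i < n" "j < n"
  shows "unit_vec n i \<bullet> (M *\<^sub>v unit_vec n j) = M $$ (i, j)"
  using assms
  by (simp add: scalar_prod_left_unit[of _ n] scalar_prod_right_unit[of _ n])

text \<open>Polarization: the unit vectors recover the diagonal, and the sums of two unit vectors
  then recover twice each remaining entry.\<close>

lemma symmetric_mat_eq_iff_quadratic_form_eq:
  fixes M M' :: "real mat"
  assumes M: "M \<in> carrier_mat n n" "symmetric_mat M"
    and M': "M' \<in> carrier_mat n n" "symmetric_mat M'"
  shows "M = M' \<longleftrightarrow> (\<forall>z \<in> carrier_vec n. z \<bullet> (M *\<^sub>v z) = z \<bullet> (M' *\<^sub>v z))"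
proof
  assume eq: "\<forall>z \<in> carrier_vec n. z \<bullet> (M *\<^sub>v z) = z \<bullet> (M' *\<^sub>v z)"
  \<comment> \<open>Symmetry of \<open>P\<close> merges the two cross terms into
    \<open>2 * P $$ (i, j)\<close>.\<close>
  have expand: "(unit_vec n i + unit_vec n j) \<bullet> (P *\<^sub>v (unit_vec n i + unit_vec n j))
      = P $$ (i, i) + 2 * P $$ (i, j) + P $$ (j, j)"
    if "P \<in> carrier_mat n n" "symmetric_mat P" "i < n" "j < n" for P :: "real mat" and i j
    using that symmetric_mat_index[OF that(2,1,3,4)]
    by (simp add: mult_add_distrib_mat_vec[of P n n] add_scalar_prod_distrib[of _ n]
        scalar_prod_add_distrib[of _ n] unit_vec_quadratic_form)
  have diag: "M $$ (i, i) = M' $$ (i, i)" if "i < n" for i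
    using eq M M' that unit_vec_quadratic_form by (metis unit_vec_carrier)
  show "M = M'"
  proof (rule eq_matI)
    fix i j assume "i < dim_row M'" "j < dim_col M'"
    then have "i < n" "j < n" using M' by auto
    then show "M $$ (i, j) = M' $$ (i, j)"
      using expand[OF M] expand[OF M'] diag
        bspec[OF eq, of "unit_vec n i + unit_vec n j"] by simp
  qed (use M M' in auto)
qed simp

text \<open>The limits on \<open>k\<close> encode \<open>k < L\<close>, \<open>k \<le> i\<close> and
  \<open>i - k < K\<close>, so \<open>(i, k)\<close> and \<open>(k, i - k)\<close> correspond
  bijectively: the left side traverses the L by K rectangle along its antidiagonals.\<close>

lemma sum_convolution:
  fixes f :: "nat \<Rightarrow> nat \<Rightarrow> 'a :: comm_monoid_add"
  assumes "0 < L" "0 < K"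
  shows "(\<Sum>i<L + K - 1. \<Sum>k = i - (K - 1)..min (L - 1) i. f k (i - k))
    = (\<Sum>k<L. \<Sum>m<K. f k m)"
  unfolding sum.Sigma[OF finite_lessThan ballI[OF finite_atLeastAtMost]]
    sum.Sigma[OF finite_lessThan ballI[OF finite_lessThan]]
  by (rule sum.reindex_bij_witness[where i = "\<lambda>(k, m). (k + m, k)" and j = "\<lambda>(i, k). (k, i - k)"])
    (use assms in auto)

lemma mat_conv_carrier:
  assumes "A \<in> carrier_mat L L" "B \<in> carrier_mat K K"
  shows "mat_conv A B \<in> carrier_mat (L + K - 1) (L + K - 1)"
  using assms by (simp add: mat_conv_def)

lemma symmetric_mat_conv:
  assumes "0 < L" "0 < K"
    and A: "A \<in> carrier_mat L L" "symmetric_mat A"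
    and B: "B \<in> carrier_mat K K" "symmetric_mat B"
  shows "symmetric_mat (mat_conv A B)"
  unfolding symmetric_mat_def
proof (rule eq_matI)
  fix i j assume "i < dim_row (mat_conv A B)" "j < dim_col (mat_conv A B)"
  then have ij: "i < L + K - 1" "j < L + K - 1"
    using A B by (auto simp: mat_conv_def)
  have "(\<Sum>k = j - (K - 1)..min (L - 1) j. \<Sum>l = i - (K - 1)..min (L - 1) i.
          A $$ (k, l) * B $$ (j - k, i - l))
      = (\<Sum>k = j - (K - 1)..min (L - 1) j. \<Sum>l = i - (K - 1)..min (L - 1) i.
          A $$ (l, k) * B $$ (i - l, j - k))"
    \<comment> \<open>The limits keep \<open>k, l\<close> below \<open>L\<close> and
      \<open>j - k, i - l\<close> below \<open>K\<close>, so every entry that is transposed lies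
      inside its matrix.\<close>
    by (intro sum.cong refl arg_cong2[where f = "(*)"]
        symmetric_mat_index[OF A(2,1)] symmetric_mat_index[OF B(2,1)])
      (use assms(1,2) in auto)
  also have "\<dots> = (\<Sum>k = i - (K - 1)..min (L - 1) i. \<Sum>l = j - (K - 1)..min (L - 1) j.
          A $$ (k, l) * B $$ (i - k, j - l))"
    by (rule sum.swap)
  finally show "transpose_mat (mat_conv A B) $$ (i, j) = mat_conv A B $$ (i, j)"
    using A B ij by (simp add: mat_conv_def)
qed (use A B in \<open>auto simp: mat_conv_def\<close>)

text \<open>The antidiagonal reindexing is applied twice, once to the row indices of the convolution
  and once to its column indices.\<close>

lemma mat_conv_quadratic_form:
  fixes A B :: "'a :: comm_semiring_0 mat"
  assumes pos: "0 < L" "0 < K"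
    and A: "A \<in> carrier_mat L L" and B: "B \<in> carrier_mat K K"
    and z: "z \<in> carrier_vec (L + K - 1)"
  shows "z \<bullet> (mat_conv A B *\<^sub>v z)
    = (\<Sum>k<L. \<Sum>m<K. \<Sum>l<L. \<Sum>n<K. z $ (k + m) * z $ (l + n) * (A $$ (k, l) * B $$ (m, n)))"
proof -
  let ?N = "L + K - 1"
  let ?I = "\<lambda>i. {i - (K - 1)..min (L - 1) i}"
  have "z \<bullet> (mat_conv A B *\<^sub>v z)
      = (\<Sum>i<?N. \<Sum>j<?N. z $ i * z $ j *
          (\<Sum>k\<in>?I i. \<Sum>l\<in>?I j. A $$ (k, l) * B $$ (i - k, j - l)))"
    unfolding quadratic_form_eq_sum[OF mat_conv_carrier[OF A B] z]
    using A B by (simp add: mat_conv_def)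
  \<comment> \<open>Swapping the sums over \<open>j\<close> and \<open>k\<close> puts each index
    next to its own splitting. Writing \<open>i\<close> as \<open>k + (i - k)\<close> and
    \<open>j\<close> as \<open>l + (j - l)\<close>, valid since \<open>k \<le> i\<close> and
    \<open>l \<le> j\<close>, gives the summand the shape \<open>f k (i - k)\<close>.\<close>
  also have "\<dots> = (\<Sum>i<?N. \<Sum>k\<in>?I i. \<Sum>j<?N. \<Sum>l\<in>?I j.
      z $ (k + (i - k)) * z $ (l + (j - l)) * (A $$ (k, l) * B $$ (i - k, j - l)))"
    unfolding sum_distrib_left by (subst (2) sum.swap) (auto intro!: sum.cong)
  also have "\<dots> = (\<Sum>i<?N. \<Sum>k\<in>?I i. \<Sum>l<L. \<Sum>n<K.
      z $ (k + (i - k)) * z $ (l + n) * (A $$ (k, l) * B $$ (i - k, n)))"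
    by (intro sum.cong refl sum_convolution[OF pos])
  also have "\<dots> = (\<Sum>k<L. \<Sum>m<K. \<Sum>l<L. \<Sum>n<K.
      z $ (k + m) * z $ (l + n) * (A $$ (k, l) * B $$ (m, n)))"
    by (rule sum_convolution[OF pos])
  finally show ?thesis .
qed

lemma mat_trace_sandwich:
  fixes A B X :: "'a :: comm_semiring_0 mat"
  assumes A: "A \<in> carrier_mat L L" and B: "B \<in> carrier_mat K K" and X: "X \<in> carrier_mat L K"
  shows "mat_trace (A * X * B * transpose_mat X)
    = (\<Sum>k<L. \<Sum>m<K. \<Sum>l<L. \<Sum>n<K. X $$ (k, m) * X $$ (l, n) * (A $$ (k, l) * B $$ (n, m)))"
proof -
  have "mat_trace (A * X * B * transpose_mat X)
      = (\<Sum>k<L. \<Sum>m<K. (\<Sum>n<K. (\<Sum>l<L. A $$ (k, l) * X $$ (l, n)) * B $$ (n, m)) * X $$ (k, m))"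
    using A B X
    by (simp add: mat_trace_def scalar_prod_def atLeast0LessThan del: assoc_mult_mat)
  also have "\<dots> = (\<Sum>k<L. \<Sum>m<K. \<Sum>n<K. \<Sum>l<L.
      X $$ (k, m) * X $$ (l, n) * (A $$ (k, l) * B $$ (n, m)))"
    by (simp add: sum_distrib_left sum_distrib_right ac_simps)
  also have "\<dots> = (\<Sum>k<L. \<Sum>m<K. \<Sum>l<L. \<Sum>n<K.
      X $$ (k, m) * X $$ (l, n) * (A $$ (k, l) * B $$ (n, m)))"
    by (intro sum.cong refl sum.swap)
  finally show ?thesis .
qed

text \<open>The Hankel entries make the trace expansion match that of the convolution form, except
  that \<open>B\<close> appears there as \<open>B $$ (n, m)\<close>; its symmetry closes this
  gap.\<close>

lemma mat_trace_trajectory_mat: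
  fixes A B :: "real mat"
  assumes pos: "0 < L" "0 < K"
    and A: "A \<in> carrier_mat L L" and B: "B \<in> carrier_mat K K" "symmetric_mat B"
    and z: "z \<in> carrier_vec (L + K - 1)"
  shows "mat_trace (A * trajectory_mat L z * B * transpose_mat (trajectory_mat L z))
    = z \<bullet> (mat_conv A B *\<^sub>v z)"
proof -
  have dim: "dim_vec z - L + 1 = K" using pos z by simp
  then have X: "trajectory_mat L z \<in> carrier_mat L K"
    by (simp add: trajectory_mat_def)
  have entry: "trajectory_mat L z $$ (k, m) = z $ (k + m)" if "k < L" "m < K" for k m
    using that unfolding trajectory_mat_def dim by simp
  show ?thesis
    unfolding mat_trace_sandwich[OF A B(1) X] mat_conv_quadratic_form[OF pos A B(1) z]
    by (intro sum.cong refl) (simp add: entry symmetric_mat_index[OF B(2,1)])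
qed

theorem theorem1:
  fixes N L K :: nat and A B W :: "real mat"
  assumes "1 < L" and "real L \<le> real N / 2" and "K = N - L + 1"
    and "A \<in> carrier_mat L L" and "symmetric_mat A" and "nonneg_definite A"
    and "B \<in> carrier_mat K K" and "symmetric_mat B" and "nonneg_definite B"
    and "W \<in> carrier_mat N N" and "symmetric_mat W" and "pos_definite W"
  shows "(\<forall>z \<in> carrier_vec N.
            mat_seminorm A B (trajectory_mat L z) = vec_seminorm W z)
         \<longleftrightarrow> W = mat_conv A B"
proof -
  \<comment> \<open>The bound on \<open>L\<close> gives \<open>L \<le> N\<close>, so the subtraction
    in \<open>K = N - L + 1\<close> is not truncated.\<close>
  have pos: "0 < L" "0 < K" and N: "N = L + K - 1" using assms(1-3) by auto
  \<comment> \<open>\<open>sqrt\<close> is injective on all reals in HOL, so equality of the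
    seminorms is equality of the radicands.\<close>
  have "mat_seminorm A B (trajectory_mat L z) = vec_seminorm W z
      \<longleftrightarrow> z \<bullet> (W *\<^sub>v z) = z \<bullet> (mat_conv A B *\<^sub>v z)" if "z \<in> carrier_vec N" for z
    using mat_trace_trajectory_mat[OF pos assms(4,7,8)] that
    by (auto simp: N mat_seminorm_def vec_seminorm_def)
  then show ?thesis
    using symmetric_mat_eq_iff_quadratic_form_eq[OF assms(10,11), of "mat_conv A B"]
      mat_conv_carrier[OF assms(4,7)] symmetric_mat_conv[OF pos assms(4,5,7,8)]
    by (simp add: N)
qed

end
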